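(* Let $\mu,\nu\in\mathbb{R}$ with $\mu>-\frac12$, and suppose that neither $\mu+\nu$ nor $\mu-\nu$ is an odd negative integer. Then the Lommel function $s_{\mu,\nu}$ has the integral representation $$s_{\mu,\nu}(z)=z^{\mu}\int_0^1 \frac{\sin(zt)}{(1-t)^{\frac12-\mu}}\;\frac{{}_2F_1\left(\frac12+\nu,\frac12-\nu;\mu+\frac12;\frac{1-t}{2}\right)}{{}_2F_1\left(\frac12+\nu,\frac12-\nu;\mu+\frac12;\frac12\right)}\,dt .$$
   Context: ${}_2F_1$ is the Gauss hypergeometric function. When neither $\mu+\nu$ nor $\mu-\nu$ is an odd negative integer, the Lommel function is $$s_{\mu,\nu}(z)=z^{\mu+1}\sum_{k=0}^\infty \frac{(-1)^k z^{2k}}{\prod_{j=0}^{k}\left((\mu+2j+1)^2-\nu^2\right)}=\frac{z^{\mu+1}}{(\mu+1)^2-\nu^2}\,{}_1F_2\left(1;\tfrac{\mu-\nu+3}{2},\tfrac{\mu+\nu+3}{2};-\tfrac{z^2}{4}\right),$$ which is a solution of $z^2y''+zy'+(z^2-\nu^2)y=z^{\mu+1}$. Here $z\neq 0$ is complex, and the same branch of $\log z$ is used for $z^{\mu}$ and $z^{\mu+1}=z\cdot z^\mu$ on both sides. *)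

theory Defs
  imports "HOL-Analysis.Analysis"
begin

(* The value of the Gauss series; it is the function 2F1(a,b;c;x) for |x| < 1 and c not in
   {0,-1,-2,...}.  No analytic continuation is built in. *)
definition hyp2F1 :: "real \<Rightarrow> real \<Rightarrow> real \<Rightarrow> real \<Rightarrow> real" where
  "hyp2F1 a b c x = eval_fps (fps_hypergeo [a, b] [c] 1) x"

(* z^a for real a, computed with the value l of log z (exp l = z).  The function powr is the
   special case l = Ln z (for z nonzero); passing l allows every branch of the logarithm. *)
definition branch_pow :: "complex \<Rightarrow> real \<Rightarrow> complex" where
  "branch_pow l a = exp (of_real a * l)"

(* s_{mu,nu}(z), where l is the value of log z that determines z^(mu+1). *)
definition lommel_s :: "real \<Rightarrow> real \<Rightarrow> complex \<Rightarrow> complex \<Rightarrow> complex" where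
  "lommel_s \<mu> \<nu> l z =
     branch_pow l (\<mu> + 1) *
       (\<Sum>k. (-1) ^ k * z ^ (2 * k) / of_real (\<Prod>j=0..k. (\<mu> + 2 * real j + 1)\<^sup>2 - \<nu>\<^sup>2))"

definition odd_negative_integer :: "real \<Rightarrow> bool" where
  "odd_negative_integer x \<longleftrightarrow> (\<exists>m::int. odd m \<and> m < 0 \<and> x = of_int m)"

end

theory Submission
  imports Defs "HOL-Real_Asymp.Real_Asymp"
begin

text \<open>
  Put \<open>a = 1/2 + \<nu>\<close>, \<open>b = 1/2 - \<nu>\<close>, \<open>c = \<mu> + 1/2\<close>, so that \<open>a + b = 1\<close> and \<open>c > 0\<close>, and let
  \<open>F\<close> be the Gauss function with these parameters. Up to the constant \<open>F(1/2)\<close>, the kernel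
  of the integral is \<open>w(t) = (1 - t) powr (c - 1) * F((1 - t)/2)\<close>. Expanding \<open>sin (z t)\<close> in powers
  of \<open>z\<close> and integrating term by term (\<open>integral_sin_sums\<close>) reduces the representation to
  the odd moments of \<open>w\<close>: the moment of order \<open>2k + 1\<close> has to be \<open>(2k + 1)! F(1/2)\<close> divided by the
  product of \<open>(\<mu> + 2j + 1)\<^sup>2 - \<nu>\<^sup>2\<close> over \<open>j \<le> k\<close>.

  The moments obey a two-term recurrence because \<open>w\<close> is annihilated by the adjoint of the Gegenbauer
  operator \<open>L \<psi> = (c - a)(c - b) \<psi> + 2 c t \<psi>' - (1 - t\<^sup>2) \<psi>''\<close>. Lagrange's identity then evaluates the
  integral of \<open>w * L \<psi>\<close> by boundary terms alone (\<open>hyp_weight_lagrange_identity\<close>), and those at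
  \<open>t = 1\<close> vanish. On monomials \<open>L\<close> acts by
  \<open>L t^n = (n + c - a)(n + c - b) t^n - n (n - 1) t^(n - 2)\<close>, where the first coefficient is
  \<open>(\<mu> + n)\<^sup>2 - \<nu>\<^sup>2\<close>. For odd \<open>n\<close> the boundary terms at \<open>0\<close> are zero except when
  \<open>n = 1\<close>, and there they give \<open>F(1/2)\<close>.

  It remains to see that dividing by \<open>F(1/2)\<close> is legitimate. Were it zero, the recurrence would make
  all odd moments vanish, since the hypotheses on \<open>\<mu> + \<nu>\<close> and \<open>\<mu> - \<nu>\<close> say that none of the factors
  is zero. But \<open>F(0) = 1\<close> makes \<open>w\<close> positive near \<open>t = 1\<close>, where \<open>t^n\<close> concentrates, so that the moments of
  high order are positive (\<open>eventually_hyp_moment_pos\<close>).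
\<close>

section \<open>The Gauss series and its differential equation\<close>

text \<open>
  The ratio test is applied to the recurrence of the coefficients and not to their quotients, which
  are undefined from some point on when the series terminates.
\<close>
lemma fps_conv_radius_hypergeo_ge_1:
  fixes a b c :: real
  shows "fps_conv_radius (fps_hypergeo [a, b] [c] 1) \<ge> 1"
  unfolding fps_conv_radius_def
proof (rule conv_radius_geI_ex')
  fix r :: real assume r: "0 < r" "ereal r < 1"
  define A where "A = fps_nth (fps_hypergeo [a, b] [c] 1)"
  define q where "q n = (a + real n) * (b + real n) / ((c + real n) * (1 + real n))" for n
  have rec: "A (Suc n) = q n * A n" for n
    by (simp only: A_def q_def fps_hypergeo_rec) (simp add: mult_ac add_ac)
  have "(\<lambda>n. q n * r) \<longlonglongrightarrow> 1 * r"
    unfolding q_def by (intro tendsto_mult tendsto_const) real_asymp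
  hence "(\<lambda>n. \<bar>q n * r\<bar>) \<longlonglongrightarrow> r"
    using tendsto_rabs r by fastforce
  moreover have "r < (1 + r) / 2" using r by simp
  ultimately have "eventually (\<lambda>n. \<bar>q n * r\<bar> < (1 + r) / 2) sequentially"
    by (rule order_tendstoD)
  then obtain N where N: "\<And>n. n \<ge> N \<Longrightarrow> \<bar>q n * r\<bar> < (1 + r) / 2"
    by (auto simp: eventually_sequentially)
  have "summable (\<lambda>n. A n * r ^ n)"
  proof (rule summable_ratio_test)
    show "(1 + r) / 2 < 1" using r by simp
    fix n assume "N \<le> n"
    have "norm (A (Suc n) * r ^ Suc n) = \<bar>q n * r\<bar> * norm (A n * r ^ n)"
      by (simp add: rec abs_mult)
    also have "\<dots> \<le> (1 + r) / 2 * norm (A n * r ^ n)"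
      using N[OF \<open>N \<le> n\<close>] by (intro mult_right_mono) auto
    finally show "norm (A (Suc n) * r ^ Suc n) \<le> (1 + r) / 2 * norm (A n * r ^ n)" .
  qed
  thus "summable (\<lambda>n. fps_nth (fps_hypergeo [a, b] [c] 1) n * of_real r ^ n)"
    by (simp add: A_def)
qed

text \<open>
  Comparing coefficients turns the differential equation into the recurrence
  \<open>(n + 1)(c + n) A(n + 1) = (a + n)(b + n) A(n)\<close>. At an \<open>n\<close> with \<open>c + n = 0\<close> it would fail in
  general, since division by zero makes \<open>A(n + 1)\<close> zero; the hypothesis on \<open>c\<close> excludes this.
\<close>
lemma fps_hypergeo_ode:
  fixes a b c :: real
  assumes "c \<notin> \<int>\<^sub>\<le>\<^sub>0"
  defines "F \<equiv> fps_hypergeo [a, b] [c] 1"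
  shows "fps_X * (1 - fps_X) * fps_deriv (fps_deriv F)
           + (fps_const c - fps_const (a + b + 1) * fps_X) * fps_deriv F = fps_const (a * b) * F"
proof (rule fps_ext)
  fix n
  have "c + real n \<noteq> 0"
    using assms(1) by (metis add_eq_0_iff minus_of_nat_in_nonpos_Ints minus_minus add.commute)
  hence rec: "(c + real n) * ((1 + real n) * fps_nth F (Suc n)) = (a + real n) * (b + real n) * fps_nth F n"
    by (simp only: F_def fps_hypergeo_rec) (simp add: divide_simps mult_ac add_ac del: fps_hypergeo_nth)
  have "fps_X * (1 - fps_X) * fps_deriv (fps_deriv F)
           + (fps_const c - fps_const (a + b + 1) * fps_X) * fps_deriv F
        = fps_X * fps_deriv (fps_deriv F) - fps_X * (fps_X * fps_deriv (fps_deriv F))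
           + fps_const c * fps_deriv F - fps_const (a + b + 1) * (fps_X * fps_deriv F)"
    by (simp add: algebra_simps)
  also have "fps_nth \<dots> n = fps_nth (fps_const (a * b) * F) n"
  proof (cases n)
    case 0
    with rec show ?thesis by simp
  next
    case (Suc m)
    show ?thesis
    proof (cases m)
      case 0
      with Suc rec show ?thesis by (simp add: algebra_simps)
    next
      case (Suc k)
      with \<open>n = Suc m\<close> rec show ?thesis by (simp add: algebra_simps)
    qed
  qed
  finally show "fps_nth (fps_X * (1 - fps_X) * fps_deriv (fps_deriv F)
      + (fps_const c - fps_const (a + b + 1) * fps_X) * fps_deriv F) n = fps_nth (fps_const (a * b) * F) n" .
qed

lemma hypergeometric_ode:
  fixes a b c x :: real
  assumes "c \<notin> \<int>\<^sub>\<le>\<^sub>0" "\<bar>x\<bar> < 1"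
  defines "F \<equiv> fps_hypergeo [a, b] [c] 1"
  shows "x * (1 - x) * eval_fps (fps_deriv (fps_deriv F)) x
           + (c - (a + b + 1) * x) * eval_fps (fps_deriv F) x = a * b * hyp2F1 a b c x"
proof -
  let ?F1 = "fps_deriv F" and ?F2 = "fps_deriv (fps_deriv F)"
  have R: "ereal (norm x) < fps_conv_radius F"
    using assms fps_conv_radius_hypergeo_ge_1[of a b c]
    by (metis F_def ereal_less(3) order_less_le_trans real_norm_def)
  have R1: "ereal (norm x) < fps_conv_radius ?F1"
    using R fps_conv_radius_deriv by (rule order_less_le_trans)
  have R2: "ereal (norm x) < fps_conv_radius ?F2"
    using R1 fps_conv_radius_deriv by (rule order_less_le_trans)
  have X: "fps_conv_radius (fps_const (a + b + 1) * fps_X) = \<infinity>"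
      "fps_conv_radius (fps_const c - fps_const (a + b + 1) * fps_X) = \<infinity>"
      "fps_conv_radius (1 - fps_X :: real fps) = \<infinity>"
      "fps_conv_radius (fps_X * (1 - fps_X) :: real fps) = \<infinity>"
    using fps_conv_radius_mult[of "fps_const (a + b + 1)" fps_X]
      fps_conv_radius_diff[of "fps_const c" "fps_const (a + b + 1) * fps_X"]
      fps_conv_radius_diff[of 1 "fps_X :: real fps"] fps_conv_radius_mult[of fps_X "1 - fps_X :: real fps"]
    by auto
  have Y: "ereal (norm x) < fps_conv_radius (fps_X * (1 - fps_X) * ?F2)"
      "ereal (norm x) < fps_conv_radius ((fps_const c - fps_const (a + b + 1) * fps_X) * ?F1)"
    using fps_conv_radius_mult[of "fps_X * (1 - fps_X)" ?F2] R2 X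
      fps_conv_radius_mult[of "fps_const c - fps_const (a + b + 1) * fps_X" ?F1] R1
    by (auto intro: order_less_le_trans)
  have "eval_fps (fps_X * (1 - fps_X) * ?F2 + (fps_const c - fps_const (a + b + 1) * fps_X) * ?F1) x
      = eval_fps (fps_const (a * b) * F) x"
    using fps_hypergeo_ode[OF assms(1), of a b] by (simp only: F_def)
  thus ?thesis
    using R R1 R2 X Y
    by (simp add: eval_fps_add eval_fps_mult eval_fps_diff hyp2F1_def F_def)
qed

section \<open>The weight function\<close>

text \<open>
  For \<open>a + b = 1\<close> this is, up to a constant factor, \<open>(1 - t\<^sup>2) powr ((c - 1)/2)\<close> times the Ferrers
  function of degree \<open>-a\<close> and order \<open>1 - c\<close> on \<open>(-1, 1)\<close>.
\<close>
definition hyp_weight :: "real \<Rightarrow> real \<Rightarrow> real \<Rightarrow> real \<Rightarrow> real" where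
  "hyp_weight a b c t = (1 - t) powr (c - 1) * hyp2F1 a b c ((1 - t) / 2)"

lemma continuous_on_hyp2F1_half:
  "continuous_on {0..1} (\<lambda>t. hyp2F1 a b c ((1 - t) / 2))"
proof -
  have "(\<lambda>t. (1 - t) / 2) ` {0..1::real} \<subseteq> eball 0 (fps_conv_radius (fps_hypergeo [a, b] [c] 1))"
  proof (intro subsetI)
    fix y assume "y \<in> (\<lambda>t. (1 - t) / 2) ` {0..1::real}"
    hence "ereal (norm y) < 1" by auto
    also note fps_conv_radius_hypergeo_ge_1[of a b c]
    finally show "y \<in> eball 0 (fps_conv_radius (fps_hypergeo [a, b] [c] 1))" by simp
  qed
  thus ?thesis unfolding hyp2F1_def by (intro continuous_intros) auto
qed

text \<open>
  The exponent may be negative, so the integral is improper at \<open>1\<close>; it exists because the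
  antiderivative \<open>- (1 - t) powr c / c\<close> still has a limit there.
\<close>
lemma set_integrable_powr_at_1:
  assumes "c > 0"
  shows "set_integrable lborel {0..1} (\<lambda>t::real. (1 - t) powr (c - 1))"
proof -
  have "set_integrable lborel (einterval (ereal 0) (ereal 1)) (\<lambda>t::real. (1 - t) powr (c - 1))"
  proof (rule interval_integral_FTC_nonneg(1)[where F = "\<lambda>t. - ((1 - t) powr c) / c" and A = "-1/c" and B = 0])
    fix x :: real assume "ereal 0 < ereal x" "ereal x < ereal 1"
    thus "((\<lambda>t. - ((1 - t) powr c) / c) has_real_derivative (1 - x) powr (c - 1)) (at x)"
      using assms by (auto intro!: derivative_eq_intros)
    show "isCont (\<lambda>t. (1 - t) powr (c - 1)) x"
      using \<open>ereal x < ereal 1\<close> by (auto intro!: continuous_intros)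
  next
    have "((\<lambda>t. - ((1 - t) powr c) / c) \<longlongrightarrow> - ((1 - 0) powr c) / c) (at_right 0)"
      by (intro tendsto_intros) (use assms in auto)
    thus "(((\<lambda>t. - ((1 - t) powr c) / c) \<circ> real_of_ereal) \<longlongrightarrow> -1/c) (at_right (ereal 0))"
      by (simp add: ereal_tendsto_simps)
    have "continuous_on {0..1} (\<lambda>t. - ((1 - t) powr c) / c)"
      using assms by (intro continuous_intros continuous_on_powr') auto
    hence "((\<lambda>t. - ((1 - t) powr c) / c) \<longlongrightarrow> - ((1 - 1) powr c) / c) (at_left 1)"
      unfolding continuous_on_def by (auto dest!: bspec[of _ _ 1] simp: at_within_Icc_at_left)
    thus "(((\<lambda>t. - ((1 - t) powr c) / c) \<circ> real_of_ereal) \<longlongrightarrow> 0) (at_left (ereal 1))"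
      by (simp add: ereal_tendsto_simps)
  qed auto
  hence I: "set_integrable lborel {0<..<1} (\<lambda>t::real. (1 - t) powr (c - 1))"
    by (simp add: einterval_eq)
  have "set_integrable lborel {0..0} (\<lambda>t::real. (1 - t) powr (c - 1))"
       "set_integrable lborel {1..1} (\<lambda>t::real. (1 - t) powr (c - 1))"
    by (intro borel_integrable_atLeastAtMost' continuous_on_sing; simp)+
  hence "set_integrable lborel ({0<..<1} \<union> ({0} \<union> {1})) (\<lambda>t::real. (1 - t) powr (c - 1))"
    using I by (intro set_integrable_Un) auto
  also have "{0<..<1} \<union> ({0} \<union> {1}) = {0..1::real}" by auto
  finally show ?thesis .
qed

lemma set_integrable_mult_continuous:
  fixes f :: "real \<Rightarrow> real" and g :: "real \<Rightarrow> 'a :: {real_normed_algebra, banach, second_countable_topology}"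
  assumes f: "set_integrable lborel {a..b} f" and g: "continuous_on {a..b} g"
  shows "set_integrable lborel {a..b} (\<lambda>t. f t *\<^sub>R g t)"
proof -
  obtain B where B: "\<And>t. t \<in> {a..b} \<Longrightarrow> norm (g t) \<le> B"
    using compact_imp_bounded[OF compact_continuous_image[OF g compact_Icc]]
    unfolding bounded_iff by blast
  have "set_borel_measurable lborel {a..b} (\<lambda>t. f t *\<^sub>R g t)"
  proof -
    have [measurable]: "(\<lambda>t. indicator {a..b} t *\<^sub>R f t) \<in> borel_measurable lborel"
      using f by (auto simp: set_integrable_def)
    have [measurable]: "(\<lambda>t. indicator {a..b} t *\<^sub>R g t) \<in> borel_measurable lborel"
      using borel_integrable_atLeastAtMost'[OF g] by (auto simp: set_integrable_def)
    have "(\<lambda>t. (indicator {a..b} t *\<^sub>R f t) *\<^sub>R (indicator {a..b} t *\<^sub>R g t)) \<in> borel_measurable lborel"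
      by measurable
    also have "(\<lambda>t. (indicator {a..b} t *\<^sub>R f t) *\<^sub>R (indicator {a..b} t *\<^sub>R g t))
        = (\<lambda>t. indicator {a..b} t *\<^sub>R (f t *\<^sub>R g t))"
      by (auto simp: fun_eq_iff indicator_def)
    finally show ?thesis unfolding set_borel_measurable_def .
  qed
  moreover have "set_integrable lborel {a..b} (\<lambda>t. f t * B)"
    using f by auto
  moreover have "norm (f t *\<^sub>R g t) \<le> norm (f t * B)" if "t \<in> {a..b}" for t
    using B[OF that] by (auto simp: abs_mult intro!: mult_left_mono)
  ultimately show ?thesis
    by (auto intro: set_integrable_bound[where f = "\<lambda>t. f t * B" and M = lborel and A = "{a..b}", OF _ _ AE_I2])
qed

lemma set_integrable_hyp_weight:
  assumes "c > 0"
  shows "set_integrable lborel {0..1} (hyp_weight a b c)"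
  using set_integrable_mult_continuous[OF set_integrable_powr_at_1[OF assms] continuous_on_hyp2F1_half[of a b c]]
  by (simp add: hyp_weight_def[abs_def])

lemma set_integrable_hyp_weight_mult:
  fixes g :: "real \<Rightarrow> 'a :: {real_normed_algebra, banach, second_countable_topology}"
  assumes "c > 0" "continuous_on {0..1} g"
  shows "set_integrable lborel {0..1} (\<lambda>t. hyp_weight a b c t *\<^sub>R g t)"
  using set_integrable_mult_continuous[OF set_integrable_hyp_weight[OF assms(1)] assms(2)] .

section \<open>Lagrange's identity and the moments\<close>

text \<open>
  The integrand is the derivative of
  \<open>G = - (1 - t) powr c * (\<psi> ((c - 1) F + (1 + t) F' / 2) + \<psi>' (1 + t) F)\<close>, with \<open>F\<close> and \<open>F'\<close> taken at
  \<open>(1 - t)/2\<close>. This is the bilinear concomitant \<open>\<psi> ((1 - t\<^sup>2) w' + 2 (c - 1) t w) - \<psi>' (1 - t\<^sup>2) w\<close> after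
  the terms in \<open>(1 - t) powr (c - 1)\<close> have cancelled. What is left carries the factor
  \<open>(1 - t) powr c\<close>, which makes \<open>G\<close> continuous on the closed interval and zero at \<open>1\<close> for every
  \<open>c > 0\<close>.
\<close>
lemma hyp_weight_lagrange_identity:
  fixes a b c :: real and \<psi> \<psi>' \<psi>'' :: "real \<Rightarrow> real"
  assumes ab: "a + b = 1" and c: "c > 0"
    and \<psi>: "\<And>t. (\<psi> has_real_derivative \<psi>' t) (at t)"
    and \<psi>': "\<And>t. (\<psi>' has_real_derivative \<psi>'' t) (at t)"
    and \<psi>'': "continuous_on {0..1} \<psi>''"
  defines "F' \<equiv> eval_fps (fps_deriv (fps_hypergeo [a, b] [c] 1))"
  shows "(LINT t:{0..1}|lborel. hyp_weight a b c t *
            ((c - a) * (c - b) * \<psi> t + 2 * c * t * \<psi>' t - (1 - t\<^sup>2) * \<psi>'' t))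
       = \<psi> 0 * ((c - 1) * hyp2F1 a b c (1/2) + F' (1/2) / 2) + \<psi>' 0 * hyp2F1 a b c (1/2)"
    (is "(LINT t:_|_. ?f t) = ?R")
proof -
  define P where "P = fps_hypergeo [a, b] [c] 1"
  define F F'' where "F = eval_fps P" and "F'' = eval_fps (fps_deriv (fps_deriv P))"
  have F': "F' = eval_fps (fps_deriv P)" by (simp add: F'_def P_def)
  have FH: "hyp2F1 a b c = F" by (simp add: fun_eq_iff hyp2F1_def F_def P_def)
  define G where "G t = - ((1 - t) powr c) *
      (\<psi> t * ((c - 1) * F ((1 - t) / 2) + (1 + t) * F' ((1 - t) / 2) / 2) + \<psi>' t * ((1 + t) * F ((1 - t) / 2)))" for t
  have R: "ereal (norm x) < fps_conv_radius P" "ereal (norm x) < fps_conv_radius (fps_deriv P)"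
    if "\<bar>x\<bar> < 1" for x :: real
  proof -
    have "ereal (norm x) < 1" using that by simp
    also have "1 \<le> fps_conv_radius P"
      unfolding P_def by (rule fps_conv_radius_hypergeo_ge_1)
    finally show "ereal (norm x) < fps_conv_radius P" .
    also have "\<dots> \<le> fps_conv_radius (fps_deriv P)" by (rule fps_conv_radius_deriv)
    finally show "ereal (norm x) < fps_conv_radius (fps_deriv P)" .
  qed
  have dF: "(F has_real_derivative F' x) (at x)" "(F' has_real_derivative F'' x) (at x)" if "\<bar>x\<bar> < 1" for x
    using R[OF that] unfolding F' F_def F''_def by (auto intro: has_field_derivative_eval_fps)
  have contF: "continuous_on {0..1} (\<lambda>t. F ((1 - t) / 2))" "continuous_on {0..1} (\<lambda>t. F' ((1 - t) / 2))"
  proof -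
    have "continuous_on {-1<..<1} F" "continuous_on {-1<..<1} F'"
      by (intro DERIV_continuous_on[where D = F'] DERIV_continuous_on[where D = F''] DERIV_subset[OF dF(1)] DERIV_subset[OF dF(2)]; auto)+
    thus "continuous_on {0..1} (\<lambda>t. F ((1 - t) / 2))" "continuous_on {0..1} (\<lambda>t. F' ((1 - t) / 2))"
      by (auto intro!: continuous_intros elim!: continuous_on_compose2)
  qed
  have cont\<psi>: "continuous_on {0..1} \<psi>" "continuous_on {0..1} \<psi>'"
    using \<psi> \<psi>' by (auto intro!: continuous_at_imp_continuous_on DERIV_isCont)
  have "(?f has_integral (G 1 - G 0)) {0..1}"
  proof (rule fundamental_theorem_of_calculus_interior)
    show "continuous_on {0..1} G"
      unfolding G_def using c by (intro continuous_intros continuous_on_powr' contF cont\<psi>) auto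
  next
    fix t :: real assume t: "t \<in> {0<..<1}"
    define x where "x = (1 - t) / 2"
    have x: "\<bar>x\<bar> < 1" using t by (auto simp: x_def)
    have cn: "c \<notin> \<int>\<^sub>\<le>\<^sub>0" using c by (auto elim!: nonpos_Ints_cases)
    have ode: "(1 - t) * (1 + t) * F'' x = 4 * (a * b * F x - (c - 1 + t) * F' x)"
      using hypergeometric_ode[OF cn x, of a b] ab
      by (simp add: FH flip: P_def F' F''_def) (simp add: x_def field_simps)
    have w: "(1 - t) powr c = (1 - t) * (1 - t) powr (c - 1)"
      using t by (simp add: powr_mult_base)
    have 1: "((\<lambda>t. (1 - t) powr c) has_real_derivative - c * (1 - t) powr (c - 1)) (at t)"
      using t by (auto intro!: derivative_eq_intros)
    have 2: "((\<lambda>t. F ((1 - t) / 2)) has_real_derivative F' x * (-1/2)) (at t)"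
      unfolding x_def using x by (intro DERIV_chain2[where f = F] dF) (auto intro!: derivative_eq_intros simp: x_def)
    have 3: "((\<lambda>t. F' ((1 - t) / 2)) has_real_derivative F'' x * (-1/2)) (at t)"
      unfolding x_def using x by (intro DERIV_chain2[where f = F'] dF) (auto intro!: derivative_eq_intros simp: x_def)
    have "(G has_real_derivative
        c * (1 - t) powr (c - 1) * (\<psi> t * ((c - 1) * F x + (1 + t) * F' x / 2) + \<psi>' t * ((1 + t) * F x))
        - (1 - t) powr c * (\<psi>' t * ((c - 1) * F x + (1 + t) * F' x / 2)
            + \<psi> t * ((c - 1) * (F' x * (-1/2)) + (F' x + (1 + t) * (F'' x * (-1/2))) / 2)
            + \<psi>'' t * ((1 + t) * F x) + \<psi>' t * (F x + (1 + t) * (F' x * (-1/2))))) (at t)"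
      unfolding G_def
      by (rule 1 2 3 \<psi> \<psi>' DERIV_cdivide derivative_eq_intros refl)+ (simp only: x_def, simp add: algebra_simps add_divide_distrib diff_divide_distrib)
    also have "(c * (1 - t) powr (c - 1) * (\<psi> t * ((c - 1) * F x + (1 + t) * F' x / 2) + \<psi>' t * ((1 + t) * F x))
        - (1 - t) powr c * (\<psi>' t * ((c - 1) * F x + (1 + t) * F' x / 2)
            + \<psi> t * ((c - 1) * (F' x * (-1/2)) + (F' x + (1 + t) * (F'' x * (-1/2))) / 2)
            + \<psi>'' t * ((1 + t) * F x) + \<psi>' t * (F x + (1 + t) * (F' x * (-1/2))))) = ?f t"
      (is "?lhs = _")
    proof -
      have b: "b = 1 - a" using ab by simp
      define W where "W = (1 - t) powr (c - 1)"
      \<comment> \<open>The two sides differ by a multiple of the hypergeometric equation at \<open>x\<close>.\<close>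
      have "?lhs - ?f t = W * \<psi> t / 4 * ((1 - t) * (1 + t) * F'' x - 4 * (a * b * F x - (c - 1 + t) * F' x))"
        unfolding w hyp_weight_def FH x_def[symmetric] W_def[symmetric] unfolding b
        by (simp add: field_simps power2_eq_square)
      with ode show ?thesis by simp
    qed
    finally show "(G has_vector_derivative ?f t) (at t)"
      by (simp add: has_real_derivative_iff_has_vector_derivative)
  qed auto
  moreover have "set_integrable lborel {0..1} ?f"
    using set_integrable_hyp_weight_mult[OF c, of "\<lambda>t. (c - a) * (c - b) * \<psi> t + 2 * c * t * \<psi>' t - (1 - t\<^sup>2) * \<psi>'' t"]
    by (simp add: cont\<psi> \<psi>'' continuous_intros)
  ultimately have "(LINT t:{0..1}|lborel. ?f t) = G 1 - G 0"
    by (simp add: set_borel_integral_eq_integral(2) integral_unique)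
  also have "\<dots> = ?R"
    using c by (simp add: G_def FH algebra_simps)
  finally show ?thesis .
qed

definition hyp_moment :: "real \<Rightarrow> real \<Rightarrow> real \<Rightarrow> nat \<Rightarrow> real" where
  "hyp_moment a b c n = (LINT t:{0..1}|lborel. hyp_weight a b c t * t ^ n)"

text \<open>
  Lagrange's identity for \<open>\<psi> t = t\<close>, an eigenfunction of the Gegenbauer operator.
\<close>
lemma hyp_moment_1:
  assumes "a + b = 1" "c > 0"
  shows "(1 + c - a) * (1 + c - b) * hyp_moment a b c 1 = hyp2F1 a b c (1/2)"
proof -
  have "hyp2F1 a b c (1/2) = (LINT t:{0..1}|lborel. hyp_weight a b c t *
            ((c - a) * (c - b) * t + 2 * c * t * 1 - (1 - t\<^sup>2) * 0))"
    by (subst hyp_weight_lagrange_identity[OF assms]) (auto intro!: derivative_eq_intros)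
  also have "\<dots> = (LINT t:{0..1}|lborel. ((1 + c - a) * (1 + c - b)) * (hyp_weight a b c t * t ^ 1))"
  proof (intro set_lebesgue_integral_cong, goal_cases)
    case 2
    have b: "b = 1 - a" using assms(1) by simp
    show ?case unfolding b by (simp add: algebra_simps)
  qed auto
  also have "\<dots> = (1 + c - a) * (1 + c - b) * hyp_moment a b c 1"
    unfolding hyp_moment_def by simp
  finally show ?thesis by simp
qed

text \<open>
  Lagrange's identity for a power that vanishes to second order at \<open>0\<close>, so that it has no
  boundary terms.
\<close>
lemma hyp_moment_Suc_Suc:
  assumes "a + b = 1" "c > 0"
  shows "(real (n + 2) + c - a) * (real (n + 2) + c - b) * hyp_moment a b c (n + 2)
       = real (n + 2) * real (n + 1) * hyp_moment a b c n"
proof -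
  have int: "set_integrable lborel {0..1} (\<lambda>t. hyp_weight a b c t * t ^ k)" for k
    using set_integrable_hyp_weight_mult[OF assms(2), of "\<lambda>t. t ^ k" a b] by (simp add: continuous_intros)
  have "0 = (LINT t:{0..1}|lborel. hyp_weight a b c t *
            ((c - a) * (c - b) * t ^ (n + 2) + 2 * c * t * (real (n + 2) * t ^ (n + 1))
              - (1 - t\<^sup>2) * (real (n + 2) * (real (n + 1) * t ^ n))))"
    by (subst hyp_weight_lagrange_identity[OF assms])
       (auto intro!: derivative_eq_intros continuous_intros simp del: of_nat_add of_nat_Suc power_Suc)
  also have "\<dots> = (LINT t:{0..1}|lborel.
       ((real (n + 2) + c - a) * (real (n + 2) + c - b)) * (hyp_weight a b c t * t ^ (n + 2))
       - (real (n + 2) * real (n + 1)) * (hyp_weight a b c t * t ^ n))"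
  proof (intro set_lebesgue_integral_cong, goal_cases)
    case 2
    have b: "b = 1 - a" using assms(1) by simp
    show ?case unfolding b by (simp add: algebra_simps power2_eq_square)
  qed auto
  also have "\<dots> = (real (n + 2) + c - a) * (real (n + 2) + c - b) * hyp_moment a b c (n + 2)
       - real (n + 2) * real (n + 1) * hyp_moment a b c n"
    unfolding hyp_moment_def
    by (subst set_integral_diff) (auto intro!: int set_integrable_mult_right simp del: power_Suc power_add_numeral2)
  finally show ?thesis by simp
qed

lemma hyp_moment_odd:
  assumes "a + b = 1" "c > 0"
  shows "(\<Prod>j=0..k. (real (2 * j + 1) + c - a) * (real (2 * j + 1) + c - b)) * hyp_moment a b c (2 * k + 1)
       = fact (2 * k + 1) * hyp2F1 a b c (1/2)"
proof (induction k)
  case 0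
  show ?case using hyp_moment_1[OF assms] by simp
next
  case (Suc k)
  let ?q = "\<lambda>j. (real (2 * j + 1) + c - a) * (real (2 * j + 1) + c - b)"
  have "(\<Prod>j=0..Suc k. ?q j) * hyp_moment a b c (2 * Suc k + 1)
      = (\<Prod>j=0..k. ?q j) * (?q (Suc k) * hyp_moment a b c (2 * k + 1 + 2))"
    by (simp add: mult_ac)
  also have "?q (Suc k) * hyp_moment a b c (2 * k + 1 + 2)
      = real (2 * k + 3) * real (2 * k + 2) * hyp_moment a b c (2 * k + 1)"
    using hyp_moment_Suc_Suc[OF assms, of "2 * k + 1"] by (simp add: add_ac)
  also have "(\<Prod>j=0..k. ?q j) * (real (2 * k + 3) * real (2 * k + 2) * hyp_moment a b c (2 * k + 1))
      = real (2 * k + 3) * real (2 * k + 2) * ((\<Prod>j=0..k. ?q j) * hyp_moment a b c (2 * k + 1))"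
    by (simp only: mult_ac)
  also have "\<dots> = real (2 * k + 3) * real (2 * k + 2) * (fact (2 * k + 1) * hyp2F1 a b c (1/2))"
    by (simp only: Suc.IH)
  also have "\<dots> = fact (2 * Suc k + 1) * hyp2F1 a b c (1/2)"
    by (simp add: eval_nat_numeral algebra_simps)
  finally show ?case .
qed

section \<open>The value at one half does not vanish\<close>

text \<open>
  Scale the \<open>n\<close>-th moment by \<open>s\<close> to the power \<open>-n\<close>. On \<open>t < s\<close> the factor \<open>(t/s)^n\<close> is at most \<open>1\<close>, so that
  this part stays bounded by the integral of \<open>\<bar>f\<bar>\<close>. On \<open>t \<ge> s\<close> Bernoulli's inequality gives
  \<open>(t/s)^n \<ge> n (t/s - 1)\<close>, so that this part grows at least linearly in \<open>n\<close>.
\<close>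
lemma eventually_moment_pos:
  fixes f :: "real \<Rightarrow> real"
  assumes f: "set_integrable lborel {0..1} f" and s: "0 < s" "s < 1"
    and nonneg: "\<And>t. s \<le> t \<Longrightarrow> t \<le> 1 \<Longrightarrow> f t \<ge> 0" and pos: "\<And>t. s < t \<Longrightarrow> t < 1 \<Longrightarrow> f t > 0"
  shows "eventually (\<lambda>n. (LINT t:{0..1}|lborel. f t * t ^ n) > 0) sequentially"
proof -
  define h where "h t = f t * max 0 (t / s - 1)" for t
  have int: "set_integrable lborel {0..1} (\<lambda>t. f t * g t)" if "continuous_on {0..1} g" for g
    using set_integrable_mult_continuous[OF f that] by simp
  have inth: "set_integrable lborel {0..1} h"
    unfolding h_def by (intro int continuous_intros) (use s in auto)
  define H C where "H = (LINT t:{0..1}|lborel. h t)" and "C = (LINT t:{0..1}|lborel. \<bar>f t\<bar>)"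
  have h0: "h t \<ge> 0" if "t \<in> {0..1}" for t
    using that nonneg[of t] s by (cases "t < s") (auto simp: h_def max_def)
  have "H > 0"
  proof (rule ccontr)
    assume "\<not> H > 0"
    moreover have "H \<ge> 0" unfolding H_def set_lebesgue_integral_def
      by (intro integral_nonneg_AE AE_I2) (use h0 in \<open>auto simp: indicator_def\<close>)
    ultimately have "H = 0" by simp
    hence "AE t in lborel. indicator {0..1} t *\<^sub>R h t = 0"
      using inth h0 unfolding H_def set_lebesgue_integral_def set_integrable_def
      by (subst (asm) integral_nonneg_eq_0_iff_AE) (auto simp: indicator_def)
    hence "AE t in lborel. t \<notin> {s<..<1}"
    proof eventually_elim
      case (elim t)
      show ?case
      proof
        assume "t \<in> {s<..<1}"
        with pos[of t] s have "h t > 0" by (auto simp: h_def field_simps)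
        with elim \<open>t \<in> {s<..<1}\<close> s show False by auto
      qed
    qed
    hence "emeasure lborel {s<..<1} = 0"
      by (subst (asm) AE_iff_measurable[of "{s<..<1}"]) auto
    with s show False by simp
  qed
  obtain N where N: "real N * H > C"
    using reals_Archimedean3[OF \<open>H > 0\<close>] by blast
  have "(LINT t:{0..1}|lborel. f t * t ^ n) > 0" if "n \<ge> N" for n
  proof -
    have "0 < real n * H - C"
    proof -
      have "real N * H \<le> real n * H" using that \<open>H > 0\<close> by (intro mult_right_mono) auto
      with N show ?thesis by simp
    qed
    also have "\<dots> = (LINT t:{0..1}|lborel. real n * h t - \<bar>f t\<bar>)"
      unfolding H_def C_def using inth f
      by (subst set_integral_diff) (auto intro: set_integrable_abs)
    also have "\<dots> \<le> (LINT t:{0..1}|lborel. f t * (t / s) ^ n)"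
    proof (rule set_integral_mono)
      show "set_integrable lborel {0..1} (\<lambda>t. real n * h t - \<bar>f t\<bar>)"
        using inth f by (intro set_integral_diff set_integrable_mult_right set_integrable_abs) auto
      show "set_integrable lborel {0..1} (\<lambda>t. f t * (t / s) ^ n)"
        by (intro int continuous_intros) (use s in auto)
      fix t :: real assume t: "t \<in> {0..1}"
      show "real n * h t - \<bar>f t\<bar> \<le> f t * (t / s) ^ n"
      proof (cases "t < s")
        case True
        have "\<bar>f t * (t / s) ^ n\<bar> \<le> \<bar>f t\<bar>"
          using t True s by (auto simp: abs_mult power_abs intro!: mult_left_le power_le_one)
        with True s show ?thesis by (simp add: h_def max_def field_simps)
      next
        case False
        have "1 + real n * (t / s - 1) \<le> (1 + (t / s - 1)) ^ n"
          by (rule Bernoulli_inequality) (use t s in \<open>auto simp: field_simps\<close>)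
        hence "real n * (t / s - 1) * f t \<le> (t / s) ^ n * f t"
          using False t nonneg[of t] by (intro mult_right_mono) auto
        moreover have "h t = f t * (t / s - 1)" using False s by (simp add: h_def max_def field_simps)
        ultimately show ?thesis by (simp add: mult_ac)
      qed
    qed
    also have "\<dots> = (LINT t:{0..1}|lborel. (1 / s ^ n) * (f t * t ^ n))"
      by (intro set_lebesgue_integral_cong) (auto simp: power_divide)
    also have "\<dots> = (1 / s ^ n) * (LINT t:{0..1}|lborel. f t * t ^ n)" by simp
    finally show ?thesis using s by (simp add: zero_less_mult_iff zero_less_divide_iff)
  qed
  thus ?thesis by (auto simp: eventually_sequentially)
qed

lemma eventually_hyp_moment_pos:
  assumes "c > 0"
  shows "eventually (\<lambda>n. hyp_moment a b c n > 0) sequentially"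
proof -
  let ?F = "\<lambda>t. hyp2F1 a b c ((1 - t) / 2)"
  have "hyp2F1 a b c 0 = 1" by (simp add: hyp2F1_def eval_fps_at_0)
  moreover have "(?F \<longlongrightarrow> ?F 1) (at_left 1)"
    using continuous_on_hyp2F1_half[of a b c]
    by (auto simp: continuous_on_def at_within_Icc_at_left dest!: bspec[of _ _ 1])
  ultimately have "eventually (\<lambda>t. ?F t > 0) (at_left 1)"
    by (auto elim: order_tendstoD)
  then obtain s where s: "s < 1" "\<And>t. s < t \<Longrightarrow> t < 1 \<Longrightarrow> ?F t > 0"
    by (auto simp: eventually_at_left_field)
  define s' where "s' = (1 + max 0 s) / 2"
  have s': "s < s'" "0 < s'" "s' < 1" using s(1) by (auto simp: s'_def)
  have pos: "hyp_weight a b c t > 0" if "s' \<le> t" "t < 1" for t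
    using that s s' by (auto simp: hyp_weight_def)
  show ?thesis
    unfolding hyp_moment_def
  proof (rule eventually_moment_pos[OF set_integrable_hyp_weight[OF assms] s'(2,3)])
    fix t assume "s' \<le> t" "t \<le> 1"
    thus "hyp_weight a b c t \<ge> 0"
      using pos[of t] by (cases "t = 1") (auto simp: hyp_weight_def)
  qed (use pos in auto)
qed

text \<open>
  A zero would propagate through the recurrence to all odd moments, against their positivity for
  large orders.
\<close>
lemma hyp2F1_half_nonzero:
  assumes "a + b = 1" "c > 0" and "\<And>j. real (2 * j + 1) + c - a \<noteq> 0" "\<And>j. real (2 * j + 1) + c - b \<noteq> 0"
  shows "hyp2F1 a b c (1/2) \<noteq> 0"
proof
  assume "hyp2F1 a b c (1/2) = 0"
  hence "hyp_moment a b c (2 * k + 1) = 0" for k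
    using hyp_moment_odd[OF assms(1,2), of k] assms(3,4) by (simp del: of_nat_Suc of_nat_add of_nat_mult)
  moreover obtain N where "\<And>n. n \<ge> N \<Longrightarrow> hyp_moment a b c n > 0"
    using eventually_hyp_moment_pos[OF assms(2), of a b] by (auto simp: eventually_sequentially)
  ultimately show False by (metis le_add1 mult_2 order.strict_iff_not trans_le_add1)
qed

section \<open>Expansion of the sine and the integral representation\<close>

lemma sin_odd_powers_sums:
  fixes z :: complex
  shows "(\<lambda>k. (-1) ^ k / fact (2 * k + 1) * z ^ (2 * k + 1)) sums sin z"
proof -
  have "(\<lambda>n. \<Sum>k = n*2..<n * 2 + 2. sin_coeff k *\<^sub>R z ^ k) sums sin z"
    by (rule sums_group) (use sin_converges[of z] in auto)
  thus ?thesis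
    by (simp add: sin_coeff_def ac_simps scaleR_conv_of_real)
qed

text \<open>
  On \<open>[0, 1]\<close> the terms are dominated by \<open>\<bar>w t\<bar>\<close> times those of a convergent series
  that does not depend on \<open>t\<close>, which permits the interchange of sum and integral.
\<close>
lemma integral_sin_sums:
  fixes w :: "real \<Rightarrow> real" and z :: complex
  assumes w: "set_integrable lborel {0..1} w"
  shows "(\<lambda>k. (-1) ^ k / fact (2 * k + 1) * z ^ (2 * k + 1) * of_real (LINT t:{0..1}|lborel. w t * t ^ (2 * k + 1)))
           sums (LINT t:{0..1}|lborel. w t *\<^sub>R sin (z * of_real t))"
proof -
  define q where "q k = (-1) ^ k / fact (2 * k + 1) * z ^ (2 * k + 1)" for k
  define f where "f k t = indicator {0..1::real} t *\<^sub>R (w t *\<^sub>R (q k * of_real t ^ (2 * k + 1)))" for k t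
  have S: "(\<lambda>k. q k * of_real t ^ (2 * k + 1)) sums sin (z * of_real t)" for t
    using sin_odd_powers_sums[of "z * of_real t"] by (simp add: q_def power_mult_distrib mult_ac)
  have f_sums: "(\<lambda>k. f k t) sums (indicator {0..1} t *\<^sub>R (w t *\<^sub>R sin (z * of_real t)))" for t
    unfolding f_def by (intro sums_scaleR_right S)
  have int: "integrable lborel (f k)" for k
    unfolding f_def using set_integrable_mult_continuous[OF w, of "\<lambda>t. q k * of_real t ^ (2 * k + 1)"]
    by (simp add: set_integrable_def continuous_intros)
  have bound: "norm (f k t) \<le> norm (q k) * (indicator {0..1} t *\<^sub>R \<bar>w t\<bar>)" for k t
  proof (cases "t \<in> {0..1}")
    case True
    hence "\<bar>w t\<bar> * norm (q k) * \<bar>t\<bar> ^ (2 * k + 1) \<le> \<bar>w t\<bar> * norm (q k)"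
      by (intro mult_left_le power_le_one mult_nonneg_nonneg) auto
    thus ?thesis using True by (simp add: f_def norm_mult norm_power mult_ac del: power_Suc)
  qed (simp add: f_def)
  have q: "summable (\<lambda>k. norm (q k))"
  proof -
    have majorant: "summable (\<lambda>k. norm z * ((norm z ^ 2) ^ k / fact k))"
      using summable_exp[of "norm z ^ 2"] by (intro summable_mult) (simp add: divide_inverse mult.commute)
    have le: "norm (q k) \<le> norm z * ((norm z ^ 2) ^ k / fact k)" for k
    proof -
      have "norm (q k) = norm z * (norm z ^ 2) ^ k / fact (2 * k + 1)"
        by (simp add: q_def norm_mult norm_divide norm_power power_mult del: fact_Suc)
      also have "\<dots> \<le> norm z * (norm z ^ 2) ^ k / fact k"
        by (intro divide_left_mono fact_mono mult_nonneg_nonneg) auto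
      finally show ?thesis by simp
    qed
    show ?thesis
      by (rule summable_comparison_test'[OF majorant, of 0], simp only: real_norm_def abs_norm_cancel, rule le)
  qed
  have "(\<lambda>k. integral\<^sup>L lborel (f k)) sums (\<integral>t. (\<Sum>k. f k t) \<partial>lborel)"
  proof (rule sums_integral[OF int])
    show "AE t in lborel. summable (\<lambda>k. norm (f k t))"
      by (rule AE_I2, rule summable_comparison_test'[OF summable_mult2[OF q], of 0], simp only: real_norm_def abs_norm_cancel, rule bound)
    show "summable (\<lambda>k. \<integral>t. norm (f k t) \<partial>lborel)"
    proof (rule summable_comparison_test'[of "\<lambda>k. norm (q k) * (LINT t:{0..1}|lborel. \<bar>w t\<bar>)" 0])
      fix k
      have "(\<integral>t. norm (f k t) \<partial>lborel) \<le> (\<integral>t. norm (q k) * (indicator {0..1} t *\<^sub>R \<bar>w t\<bar>) \<partial>lborel)"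
        using set_integrable_abs[OF w]
        by (intro integral_mono integrable_norm int bound) (auto simp: set_integrable_def)
      also have "\<dots> = norm (q k) * (LINT t:{0..1}|lborel. \<bar>w t\<bar>)"
        by (simp add: set_lebesgue_integral_def)
      finally show "norm (\<integral>t. norm (f k t) \<partial>lborel) \<le> norm (q k) * (LINT t:{0..1}|lborel. \<bar>w t\<bar>)"
        by simp
    qed (rule summable_mult2[OF q])
  qed
  moreover have "(\<integral>t. (\<Sum>k. f k t) \<partial>lborel) = (LINT t:{0..1}|lborel. w t *\<^sub>R sin (z * of_real t))"
    using f_sums by (simp add: set_lebesgue_integral_def sums_iff)
  moreover have "integral\<^sup>L lborel (f k) = q k * of_real (LINT t:{0..1}|lborel. w t * t ^ (2 * k + 1))" for k
  proof -
    have "integral\<^sup>L lborel (f k) = (\<integral>t. q k * of_real (indicator {0..1} t *\<^sub>R (w t * t ^ (2 * k + 1))) \<partial>lborel)"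
      by (intro Bochner_Integration.integral_cong) (auto simp: f_def indicator_def scaleR_conv_of_real)
    also have "\<dots> = q k * of_real (LINT t:{0..1}|lborel. w t * t ^ (2 * k + 1))"
      unfolding set_lebesgue_integral_def by (simp only: integral_mult_right_zero integral_complex_of_real)
    finally show ?thesis .
  qed
  ultimately show ?thesis by (simp add: q_def)
qed

theorem proposition3p1:
  fixes \<mu> \<nu> :: real and z l :: complex
  assumes "\<mu> > -1/2"
    and "\<not> odd_negative_integer (\<mu> + \<nu>)"
    and "\<not> odd_negative_integer (\<mu> - \<nu>)"
    and "z \<noteq> 0" and "exp l = z"
  shows "let f = (\<lambda>t::real. sin (z * of_real t) / of_real ((1 - t) powr (1/2 - \<mu>)) *
      of_real (hyp2F1 (1/2 + \<nu>) (1/2 - \<nu>) (\<mu> + 1/2) ((1 - t) / 2) /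
               hyp2F1 (1/2 + \<nu>) (1/2 - \<nu>) (\<mu> + 1/2) (1/2)))
    in set_integrable lborel {0..1} f \<and>
       lommel_s \<mu> \<nu> l z = branch_pow l \<mu> * (LINT t:{0..1}|lborel. f t)"
proof -
  define a b c where "a = 1/2 + \<nu>" and "b = 1/2 - \<nu>" and "c = \<mu> + 1/2"
  have ab: "a + b = 1" and c: "c > 0" using assms(1) by (auto simp: a_def b_def c_def)
  define F where "F = hyp2F1 a b c (1/2)"
  define Q where "Q k = (\<Prod>j=0..k. (\<mu> + 2 * real j + 1)\<^sup>2 - \<nu>\<^sup>2)" for k
  define f where "f t = sin (z * of_real t) / of_real ((1 - t) powr (1/2 - \<mu>)) *
      of_real (hyp2F1 a b c ((1 - t) / 2) / F)" for t :: real
  \<comment> \<open>The factors of the product are nonzero because \<open>\<mu> + \<nu>\<close> and \<open>\<mu> - \<nu>\<close> are not odd negative integers.\<close>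
  have nz: "\<mu> + 2 * real j + 1 + x \<noteq> 0" if "\<not> odd_negative_integer (\<mu> + x)" for j x
  proof
    assume "\<mu> + 2 * real j + 1 + x = 0"
    hence "\<mu> + x = of_int (- (2 * int j + 1))" by simp
    moreover have "odd (- (2 * int j + 1))" "- (2 * int j + 1) < 0" by auto
    ultimately show False using that unfolding odd_negative_integer_def by blast
  qed
  have factors: "real (2 * j + 1) + c - a \<noteq> 0" "real (2 * j + 1) + c - b \<noteq> 0" for j
    using nz[of "- \<nu>" j] nz[of \<nu> j] assms(2,3) by (simp_all add: a_def b_def c_def algebra_simps)
  have F0: "F \<noteq> 0" unfolding F_def by (rule hyp2F1_half_nonzero[OF ab c factors])
  have Q: "Q k = (\<Prod>j=0..k. (real (2 * j + 1) + c - a) * (real (2 * j + 1) + c - b))" for k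
    unfolding Q_def by (intro prod.cong) (simp_all add: a_def b_def c_def algebra_simps power2_eq_square)
  have Q0: "Q k \<noteq> 0" for k unfolding Q using factors by simp
  have moment: "hyp_moment a b c (2 * k + 1) = fact (2 * k + 1) * F / Q k" for k
    using hyp_moment_odd[OF ab c, of k] Q0[of k] unfolding Q[symmetric] F_def by (simp add: field_simps)
  \<comment> \<open>This holds at \<open>t = 1\<close> as well: a power of \<open>0\<close> is \<open>0\<close>, and so is its reciprocal.\<close>
  have f_eq: "f = (\<lambda>t. (hyp_weight a b c t *\<^sub>R sin (z * of_real t)) / of_real F)"
  proof
    fix t :: real
    have "(1 - t) powr (c - 1) = inverse ((1 - t) powr (1/2 - \<mu>))"
      by (simp add: c_def flip: powr_minus)
    thus "f t = (hyp_weight a b c t *\<^sub>R sin (z * of_real t)) / of_real F"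
      unfolding f_def hyp_weight_def by (simp only: scaleR_conv_of_real of_real_mult of_real_divide of_real_inverse divide_inverse mult_ac)
  qed
  have "set_integrable lborel {0..1} (\<lambda>t. hyp_weight a b c t *\<^sub>R sin (z * of_real t))"
    by (intro set_integrable_hyp_weight_mult c continuous_intros)
  hence int: "set_integrable lborel {0..1} f" unfolding f_eq by simp
  have "(\<lambda>k. (-1) ^ k / fact (2 * k + 1) * z ^ (2 * k + 1) * of_real (hyp_moment a b c (2 * k + 1)))
      sums (LINT t:{0..1}|lborel. hyp_weight a b c t *\<^sub>R sin (z * of_real t))"
    unfolding hyp_moment_def by (rule integral_sin_sums[OF set_integrable_hyp_weight[OF c]])
  hence "(\<lambda>k. (-1) ^ k / fact (2 * k + 1) * z ^ (2 * k + 1) * of_real (hyp_moment a b c (2 * k + 1)) / (z * of_real F))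
      sums ((LINT t:{0..1}|lborel. hyp_weight a b c t *\<^sub>R sin (z * of_real t)) / (z * of_real F))"
    by (rule sums_divide)
  also have "(LINT t:{0..1}|lborel. hyp_weight a b c t *\<^sub>R sin (z * of_real t)) / (z * of_real F)
      = (LINT t:{0..1}|lborel. f t) / z"
    unfolding f_eq by simp
  also have "(\<lambda>k. (-1) ^ k / fact (2 * k + 1) * z ^ (2 * k + 1) * of_real (hyp_moment a b c (2 * k + 1)) / (z * of_real F))
      = (\<lambda>k. (-1) ^ k * z ^ (2 * k) / of_real (Q k))"
    unfolding moment using F0 \<open>z \<noteq> 0\<close> by (simp add: fun_eq_iff del: fact_Suc)
  finally have "(\<Sum>k. (-1) ^ k * z ^ (2 * k) / of_real (Q k)) = (LINT t:{0..1}|lborel. f t) / z"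
    by (rule sums_unique[symmetric])
  moreover have "branch_pow l (\<mu> + 1) = branch_pow l \<mu> * z"
    using assms(5) by (simp add: branch_pow_def ring_distribs exp_add)
  ultimately have "lommel_s \<mu> \<nu> l z = branch_pow l \<mu> * (LINT t:{0..1}|lborel. f t)"
    using \<open>z \<noteq> 0\<close> by (simp add: lommel_s_def Q_def)
  with int show ?thesis
    by (simp only: f_def[abs_def] F_def a_def b_def c_def Let_def)
qed

end
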